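(* Optimal decoding for the $N$-gram Hamming loss takes exponential time in the sequence length $L$, assuming black-box access to next-token probabilities. That is: let $\mathcal{V}$ be a fixed finite vocabulary with $|\mathcal{V}|\ge 2$, and for each $L\ge1$ let $1\le N\le L$. If for each $L$ we have a (deterministic or stochastic) decoding algorithm that is optimal for the $N$-gram Hamming loss on $\mathcal{V}^L$ for every next-token predictor, then its worst-case running time over all next-token predictors is at least $c\,a^{L}$ for some constants $c>0$, $a>1$ independent of $L$.
   Context: For a sequence $y=y_1\cdots y_L$, $y_{[i]}=y_1\cdots y_i$ (with $y_{[0]}$ empty) and $y_{i:j}=y_iy_{i+1}\cdots y_j$. The $N$-gram Hamming loss between $\hat y,y$ is $\sum_{i=1}^{L-N+1}\mathbf{1}\{\hat y_{i:i+N-1}\neq y_{i:i+N-1}\}$. A next-token predictor is a family of conditional probability distributions $q(\cdot\mid y_{[i-1]})$ on $\mathcal{V}$, one for every prefix $y_{[i-1]}\in\mathcal{V}^{i-1}$, $1\le i\le L$; it determines a distribution $q(y)=\prod_{i=1}^L q(y_i\mid y_{[i-1]})$ on $\mathcal{V}^L$. A decoding algorithm has access to $q$ only through adaptively chosen queries: a query specifies a prefix $y_{[i-1]}$ and a token $v\in\mathcal{V}$ and returns the number $q(v\mid y_{[i-1]})$; each query takes a fixed constant positive time. After finitely many queries the algorithm outputs a sequence $\hat y\in\mathcal{V}^L$. It is deterministic if it uses no internal randomness, and stochastic otherwise. The decoder is optimal for $q$ if its (possibly random) output $\hat y$ attains the minimum over all output rules of the expected loss $\mathbb{E}_{\hat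 y}\,\mathbb{E}_{y\sim q}\big[\sum_{i=1}^{L-N+1}\mathbf{1}\{\hat y_{i:i+N-1}\neq y_{i:i+N-1}\}\big]$, where $\hat y$ and $y$ are independent. *)

theory Defs
  imports "HOL-Probability.Probability"
begin

text \<open>The vocabulary is a finite type \<open>'v\<close>; sequences and prefixes are lists over it. A
  predictor for length \<open>L\<close> is a total function, but only its values on prefixes of length
  less than \<open>L\<close> are ever used.\<close>

type_synonym 'v predictor = "'v list \<Rightarrow> 'v pmf"

text \<open>Lists are indexed from 0, so the i-th factor of the product is the probability of
  \<open>y ! i\<close> after \<open>take i y\<close>, for \<open>i < L\<close>.\<close>

definition seq_prob :: "nat \<Rightarrow> 'v predictor \<Rightarrow> 'v list \<Rightarrow> real" where
  "seq_prob L q y = (\<Prod>i<L. pmf (q (take i y)) (y ! i))"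

definition seq_pmf :: "nat \<Rightarrow> 'v::finite predictor \<Rightarrow> 'v list pmf" where
  "seq_pmf L q = embed_pmf (\<lambda>y. if length y = L then seq_prob L q y else 0)"

lemma finite_lists_length_eq_UNIV: "finite {y :: 'v::finite list. length y = L}"
  using finite_lists_length_eq[of "UNIV :: 'v set" L] by simp

lemma seq_prob_snoc:
  assumes "length y = L"
  shows "seq_prob (Suc L) q (y @ [v]) = seq_prob L q y * pmf (q y) v"
  using assms unfolding seq_prob_def
  by (auto simp: nth_append intro!: arg_cong2[where f = "(*)"] prod.cong)

lemma sum_seq_prob: "(\<Sum>y | length y = L. seq_prob L q y) = 1"
  for q :: "'v::finite predictor"
proof (induction L)
  case 0
  then show ?case by (simp add: seq_prob_def)
next
  case (Suc L)
  have "bij_betw (\<lambda>(y, v). y @ [v]) ({y :: 'v list. length y = L} \<times> UNIV) {y. length y = Suc L}"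
    by (auto simp: bij_betw_def inj_on_def image_iff length_Suc_conv_rev)
  then have "(\<Sum>y | length y = Suc L. seq_prob (Suc L) q y)
      = (\<Sum>(y, v) \<in> {y. length y = L} \<times> UNIV. seq_prob (Suc L) q (y @ [v]))"
    by (simp add: sum.reindex_bij_betw[symmetric] case_prod_unfold)
  also have "\<dots> = (\<Sum>y | length y = L. \<Sum>v\<in>UNIV. seq_prob L q y * pmf (q y) v)"
    by (subst sum.cartesian_product[symmetric]) (simp add: seq_prob_snoc)
  also have "\<dots> = (\<Sum>y | length y = L. seq_prob L q y)"
    by (simp add: sum_distrib_left[symmetric] sum_pmf_eq_1)
  finally show ?case using Suc by simp
qed

lemma pmf_seq_pmf:
  "pmf (seq_pmf L q) y = (if length y = L then seq_prob L q y else 0)"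
  for q :: "'v::finite predictor"
proof -
  let ?f = "\<lambda>y. if length y = L then seq_prob L q y else 0"
  have nn: "0 \<le> ?f y" for y
    by (simp add: seq_prob_def prod_nonneg)
  have "(\<integral>\<^sup>+ y. ennreal (?f y) \<partial>count_space UNIV) = (\<Sum>y | length y = L. ennreal (?f y))"
    by (rule nn_integral_count_space') (auto simp: finite_lists_length_eq_UNIV)
  also have "\<dots> = ennreal (\<Sum>y | length y = L. ?f y)"
    by (rule sum_ennreal) (rule nn)
  also have "\<dots> = 1"
    using sum_seq_prob[of L q] by simp
  finally show ?thesis
    unfolding seq_pmf_def using nn by (subst pmf_embed_pmf) auto
qed

definition ngram_loss :: "nat \<Rightarrow> nat \<Rightarrow> 'v list \<Rightarrow> 'v list \<Rightarrow> real" where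
  "ngram_loss N L y' y =
     (\<Sum>i = 1..L - N + 1. of_bool (take N (drop (i - 1) y') \<noteq> take N (drop (i - 1) y)))"

definition expected_loss :: "nat \<Rightarrow> nat \<Rightarrow> 'v::finite predictor \<Rightarrow> 'v list \<Rightarrow> real" where
  "expected_loss N L q y' = measure_pmf.expectation (seq_pmf L q) (ngram_loss N L y')"

text \<open>A deterministic black-box computation: \<open>Query p v k\<close> asks for the probability of token
  \<open>v\<close> after prefix \<open>p\<close> and continues with \<open>k r\<close> on answer \<open>r\<close>. Being an inductive datatype,
  every computation stops after finitely many queries, but with no uniform bound.\<close>

datatype 'v query_tree = Output "'v list" | Query "'v list" 'v "real \<Rightarrow> 'v query_tree"

primrec tree_output :: "'v query_tree \<Rightarrow> 'v predictor \<Rightarrow> 'v list" where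
  "tree_output (Output y) q = y"
| "tree_output (Query p v k) q = tree_output (k (pmf (q p) v)) q"

primrec tree_queries :: "'v query_tree \<Rightarrow> 'v predictor \<Rightarrow> ('v list \<times> 'v) list" where
  "tree_queries (Output y) q = []"
| "tree_queries (Query p v k) q = (p, v) # tree_queries (k (pmf (q p) v)) q"

definition tree_for_length :: "nat \<Rightarrow> 'v query_tree \<Rightarrow> bool" where
  "tree_for_length L t \<longleftrightarrow> (\<forall>q. length (tree_output t q) = L \<and>
     (\<forall>(p, v) \<in> set (tree_queries t q). length p < L))"

text \<open>Internal randomness is a seed drawn in advance from an arbitrary probability space; given
  the seed, the computation is deterministic.\<close>

datatype ('v, 's) decoder =
    Deterministic "'v query_tree"
  | Stochastic "'s measure" "'s \<Rightarrow> 'v query_tree"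

fun decoder_for_length :: "nat \<Rightarrow> ('v, 's) decoder \<Rightarrow> bool" where
  "decoder_for_length L (Deterministic t) \<longleftrightarrow> tree_for_length L t"
| "decoder_for_length L (Stochastic M T) \<longleftrightarrow>
     prob_space M \<and>
     (\<forall>\<omega> \<in> space M. tree_for_length L (T \<omega>)) \<and>
     (\<forall>q. (\<lambda>\<omega>. tree_output (T \<omega>) q) \<in> M \<rightarrow>\<^sub>M count_space UNIV) \<and>
     (\<forall>q. (\<lambda>\<omega>. length (tree_queries (T \<omega>) q)) \<in> M \<rightarrow>\<^sub>M count_space UNIV)"

fun decoder_loss :: "nat \<Rightarrow> nat \<Rightarrow> 'v::finite predictor \<Rightarrow> ('v, 's) decoder \<Rightarrow> real" where
  "decoder_loss N L q (Deterministic t) = expected_loss N L q (tree_output t q)"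
| "decoder_loss N L q (Stochastic M T) = (\<integral>\<omega>. expected_loss N L q (tree_output (T \<omega>) q) \<partial>M)"

text \<open>For a fixed predictor, an output rule is a probability distribution \<open>r\<close> on the sequences
  of length \<open>L\<close>.\<close>

definition optimal_for :: "nat \<Rightarrow> nat \<Rightarrow> 'v::finite predictor \<Rightarrow> ('v, 's) decoder \<Rightarrow> bool" where
  "optimal_for N L q A \<longleftrightarrow>
     (\<forall>r. set_pmf r \<subseteq> {y. length y = L} \<longrightarrow>
       decoder_loss N L q A \<le> measure_pmf.expectation r (expected_loss N L q))"

text \<open>Each query costs \<open>\<tau>\<close>, repeated queries included, and all other computation is free. The
  running time of a stochastic decoder is its expectation over the seed, which is at most its
  largest value over the seed, so a lower bound on it is also one on the latter.\<close>

fun running_time :: "real \<Rightarrow> 'v predictor \<Rightarrow> ('v, 's) decoder \<Rightarrow> ennreal" where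
  "running_time \<tau> q (Deterministic t) = ennreal (\<tau> * real (length (tree_queries t q)))"
| "running_time \<tau> q (Stochastic M T) =
     (\<integral>\<^sup>+ \<omega>. ennreal (\<tau> * real (length (tree_queries (T \<omega>) q))) \<partial>M)"

definition worst_case_time :: "real \<Rightarrow> ('v, 's) decoder \<Rightarrow> ennreal" where
  "worst_case_time \<tau> A = (SUP q. running_time \<tau> q A)"

end

theory Submission
  imports Defs
begin

text \<open>Fix a prefix \<open>w\<close> of length \<open>L - 1\<close> and a token \<open>v\<close>, and change the uniform predictor at \<open>w\<close>
  only, to predict \<open>v\<close> with certainty. All windows but the last remain uniformly distributed, while
  the last one becomes biased towards the end of \<open>w @ [v]\<close>; so, whatever \<open>N\<close> is, every optimal
  output ends in \<open>v\<close>. A computation that does not query \<open>w\<close> on the uniform predictor gives the same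
  output for all \<open>v\<close>. Hence an optimal decoder, run on the uniform predictor, queries (almost surely)
  every one of the \<open>CARD('v) ^ (L - 1)\<close> prefixes of length \<open>L - 1\<close>.\<close>

section \<open>Unqueried prefixes, and the total loss over all sequences\<close>

lemma tree_output_cong_unqueried:
  assumes "p \<notin> fst ` set (tree_queries t q)"
  shows "tree_output t (q(p := d)) = tree_output t q"
  using assms by (induction t) auto

lemma expected_loss_sum:
  "expected_loss N L q y' = (\<Sum>y | length y = L. seq_prob L q y * ngram_loss N L y' y)"
  for q :: "'v::finite predictor"
proof -
  have "expected_loss N L q y'
      = (\<Sum>y | length y = L. ngram_loss N L y' y * pmf (seq_pmf L q) y)"
    unfolding expected_loss_def
    by (rule integral_measure_pmf_real)
       (auto simp: finite_lists_length_eq_UNIV set_pmf_eq pmf_seq_pmf split: if_splits)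
  then show ?thesis
    by (simp add: pmf_seq_pmf mult.commute)
qed

lemma card_lists_length_UNIV: "card {y :: 'v::finite list. length y = n} = CARD('v) ^ n"
  using card_lists_length_eq[of "UNIV :: 'v set" n] by simp

lemma card_lists_with_window:
  fixes z :: "'v::finite list"
  assumes "i + length z \<le> L"
  shows "card {y :: 'v list. length y = L \<and> take (length z) (drop i y) = z}
    = CARD('v) ^ (L - length z)"
proof -
  let ?A = "{a :: 'v list. length a = i}" and ?B = "{b :: 'v list. length b = L - length z - i}"
  have "{y. length y = L \<and> take (length z) (drop i y) = z} = (\<lambda>(a, b). a @ z @ b) ` (?A \<times> ?B)"
    (is "?S = ?T")
  proof
    show "?S \<subseteq> ?T"
    proof
      fix y assume y: "y \<in> ?S"
      then have "y = take i y @ z @ drop (length z) (drop i y)"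
        using append_take_drop_id[of i y] append_take_drop_id[of "length z" "drop i y"] by simp
      moreover have "(take i y, drop (length z) (drop i y)) \<in> ?A \<times> ?B"
        using y assms by auto
      ultimately show "y \<in> ?T"
        by (intro image_eqI[where x = "(take i y, drop (length z) (drop i y))"]) simp_all
    qed
    show "?T \<subseteq> ?S"
      using assms by auto
  qed
  moreover have "inj_on (\<lambda>(a, b). a @ z @ b) (?A \<times> ?B)"
    by (auto simp: inj_on_def)
  moreover have "CARD('v) ^ i * CARD('v) ^ (L - length z - i) = CARD('v) ^ (L - length z)"
    using assms by (simp flip: power_add)
  ultimately show ?thesis
    by (simp only: card_image card_cartesian_product card_lists_length_UNIV)
qed

text \<open>Whatever N-gram \<open>y'\<close> shows in a given window, exactly
  \<open>CARD('v) ^ (L - N)\<close> sequences agree with it there. So the total does not depend on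
  \<open>y'\<close>: under the uniform predictor all outputs are equally good, and any perturbation
  decides.\<close>

lemma sum_ngram_loss:
  fixes y' :: "'v::finite list"
  assumes "N \<le> L" "length y' = L"
  shows "(\<Sum>y | length y = L. ngram_loss N L y' y)
    = real (L - N + 1) * (real (CARD('v) ^ L) - real (CARD('v) ^ (L - N)))"
proof -
  have "(\<Sum>y | length y = L. of_bool (take N (drop (i - 1) y') \<noteq> take N (drop (i - 1) y)))
      = real (CARD('v) ^ L) - real (CARD('v) ^ (L - N))" if "i \<in> {1..L - N + 1}" for i
  proof -
    let ?z = "take N (drop (i - 1) y')"
    have len: "length ?z = N" "i - 1 + length ?z \<le> L"
      using that assms by auto
    have "(\<Sum>y | length y = L. of_bool (?z \<noteq> take N (drop (i - 1) y)))
        = (\<Sum>y | length (y :: 'v list) = L. 1 - of_bool (take N (drop (i - 1) y) = ?z) :: real)"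
      by (intro sum.cong) auto
    also have "\<dots> = real (CARD('v) ^ L)
        - card {y :: 'v list. length y = L \<and> take N (drop (i - 1) y) = ?z}"
      by (simp add: sum_subtractf card_lists_length_UNIV of_bool_def finite_lists_length_eq_UNIV
          sum.If_cases Int_def)
    also have "\<dots> = real (CARD('v) ^ L) - real (CARD('v) ^ (L - N))"
      using card_lists_with_window[OF len(2)] len(1) by simp
    finally show ?thesis .
  qed
  then show ?thesis
    unfolding ngram_loss_def by (subst sum.swap) simp
qed

text \<open>Only the last window contains the final token; all others lie inside \<open>w\<close>,
  so their contribution is constant in \<open>u\<close> and can cancel later.\<close>

lemma ngram_loss_snoc:
  assumes "1 \<le> N" "N \<le> Suc m" "length w = m" "length y' = Suc m"
  shows "ngram_loss N (Suc m) y' (w @ [u])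
    = (\<Sum>i = 1..Suc m - N. of_bool (take N (drop (i - 1) y') \<noteq> take N (drop (i - 1) w)))
      + of_bool (drop (Suc m - N) y' \<noteq> drop (Suc m - N) w @ [u])"
proof -
  have "(\<Sum>i = 1..Suc m - N. of_bool (take N (drop (i - 1) y') \<noteq> take N (drop (i - 1) (w @ [u]))))
      = (\<Sum>i = 1..Suc m - N.
          of_bool (take N (drop (i - 1) y') \<noteq> take N (drop (i - 1) w)) :: real)"
    using assms by (intro sum.cong) auto
  then show ?thesis
    using assms unfolding ngram_loss_def by simp
qed

section \<open>Spiked predictors and their optimal outputs\<close>

definition uniform_predictor :: "'v::finite predictor" where
  "uniform_predictor p = pmf_of_set UNIV"

definition spiked_predictor :: "'v::finite list \<Rightarrow> 'v \<Rightarrow> 'v predictor" where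
  "spiked_predictor w v = uniform_predictor(w := return_pmf v)"

text \<open>The spike sits at a prefix of length \<open>m\<close>, so it can change only the last
  factor. The form "uniform weight plus a correction supported on extensions of \<open>w\<close>"
  lets the expected loss split accordingly.\<close>

lemma seq_prob_spiked:
  fixes w :: "'v::finite list"
  assumes "length w = m" "length y = Suc m"
  shows "seq_prob (Suc m) (spiked_predictor w v) y = (1 / CARD('v)) ^ m *
    (1 / CARD('v) + of_bool (take m y = w) * (of_bool (y ! m = v) - 1 / CARD('v)))"
proof -
  have "(\<Prod>i<m. pmf (spiked_predictor w v (take i y)) (y ! i)) = (\<Prod>i<m. 1 / real CARD('v))"
    using assms
    by (intro prod.cong) (auto simp: spiked_predictor_def uniform_predictor_def)
  then show ?thesis
    using assms
    by (auto simp: seq_prob_def spiked_predictor_def uniform_predictor_def indicator_def)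
qed

lemma sum_over_extensions:
  fixes f :: "'v::finite list \<Rightarrow> real"
  assumes "length w = m"
  shows "(\<Sum>y | length y = Suc m. of_bool (take m y = w) * f y) = (\<Sum>u\<in>UNIV. f (w @ [u]))"
proof -
  have eq: "{y. length y = Suc m \<and> take m y = w} = range (\<lambda>u. w @ [u])"
    using assms by (auto simp: length_Suc_conv_rev)
  have "(\<Sum>y | length y = Suc m. of_bool (take m y = w) * f y)
      = (\<Sum>y | length y = Suc m \<and> take m y = w. f y)"
    by (rule sum.mono_neutral_cong_right) (auto simp: finite_lists_length_eq_UNIV)
  also have "\<dots> = (\<Sum>u\<in>UNIV. f (w @ [u]))"
    unfolding eq by (subst sum.reindex) (auto simp: inj_on_def)
  finally show ?thesis .
qed

text \<open>The uniform part is the total computed in \<open>sum_ngram_loss\<close>. The correction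
  weights over the extensions of \<open>w\<close> add up to 0, so only the last window's loss
  \<open>B\<close> survives, as its value at \<open>v\<close> minus its average over all
  tokens.\<close>

lemma expected_loss_spiked:
  fixes w :: "'v::finite list"
  assumes N: "1 \<le> N" "N \<le> Suc m" and len: "length w = m" "length y' = Suc m"
  defines "B \<equiv> \<lambda>u. of_bool (drop (Suc m - N) y' \<noteq> drop (Suc m - N) w @ [u]) :: real"
  shows "expected_loss N (Suc m) (spiked_predictor w v) y' =
    (1 / CARD('v)) ^ m *
      (real (Suc m - N + 1) * (real (CARD('v) ^ Suc m) - real (CARD('v) ^ (Suc m - N))) / CARD('v)
       + (B v - (\<Sum>u\<in>UNIV. B u) / CARD('v)))"
proof -
  let ?K = "real CARD('v)"
  let ?l = "ngram_loss N (Suc m) y'"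
  define A :: real where
    "A = (\<Sum>i = 1..Suc m - N. of_bool (take N (drop (i - 1) y') \<noteq> take N (drop (i - 1) w)))"
  have l: "?l (w @ [u]) = A + B u" for u
    using ngram_loss_snoc[OF N len] by (simp add: A_def B_def)
  have "expected_loss N (Suc m) (spiked_predictor w v) y'
      = (\<Sum>y | length y = Suc m. (1 / ?K) ^ m *
          (?l y / ?K + of_bool (take m y = w) * ((of_bool (y ! m = v) - 1 / ?K) * ?l y)))"
    unfolding expected_loss_sum
    by (intro sum.cong) (auto simp: seq_prob_spiked[OF len(1)] algebra_simps)
  also have "\<dots> = (1 / ?K) ^ m * ((\<Sum>y | length y = Suc m. ?l y) / ?K
      + (\<Sum>u\<in>UNIV. (of_bool (u = v) - 1 / ?K) * (A + B u)))"
    using len(1)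
    by (simp only: sum_distrib_left[symmetric] sum.distrib sum_over_extensions
        sum_divide_distrib[symmetric] l) (simp add: nth_append)
  also have "(\<Sum>u\<in>UNIV. (of_bool (u = v) - 1 / ?K) * (A + B u))
      = (\<Sum>u\<in>UNIV. of_bool (u = v) * (A + B u)) - (\<Sum>u\<in>UNIV. A + B u) / ?K"
    by (simp add: left_diff_distrib sum_subtractf sum_divide_distrib)
  also have "(\<Sum>u\<in>UNIV. of_bool (u = v) * (A + B u)) = A + B v"
    by (simp add: of_bool_def if_distrib[of "\<lambda>x. x * _"] cong: if_cong)
  \<comment> \<open>The loss \<open>A\<close> of the earlier windows equals its own average and
    drops out.\<close>
  also have "A + B v - (\<Sum>u\<in>UNIV. A + B u) / ?K = B v - (\<Sum>u\<in>UNIV. B u) / ?K"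
    by (simp add: sum.distrib add_divide_distrib)
  finally show ?thesis
    by (simp only: sum_ngram_loss[OF N(2) len(2)])
qed

text \<open>If the last window of \<open>y'\<close> is that of \<open>w @ [v]\<close>, then
  \<open>B v\<close> is 0 while the average of \<open>B\<close> is (K - 1) / K > 0 with K =
  \<open>CARD('v)\<close>, so the correction is negative. Otherwise \<open>B v\<close> is 1 and no
  average of \<open>B\<close> exceeds 1, so it is nonnegative.\<close>

lemma expected_loss_spiked_minimum:
  fixes w :: "'v::finite list" and v :: 'v
  assumes K: "CARD('v) \<ge> 2" and N: "1 \<le> N" "N \<le> Suc m"
    and len: "length w = m" "length y' = Suc m"
  defines "E \<equiv> expected_loss N (Suc m) (spiked_predictor w v)"
  shows "E (w @ [v]) \<le> E y'" and "last y' \<noteq> v \<Longrightarrow> E (w @ [v]) < E y'"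
proof -
  let ?K = "real CARD('v)"
  define B where "B = (\<lambda>y u. of_bool (drop (Suc m - N) y \<noteq> drop (Suc m - N) w @ [u]) :: real)"
  define C where "C = real (Suc m - N + 1) * (real (CARD('v) ^ Suc m) - real (CARD('v) ^ (Suc m - N))) / ?K"
  have E: "E y = (1 / ?K) ^ m * (C + (B y v - (\<Sum>u\<in>UNIV. B y u) / ?K))"
    if "length y = Suc m" for y
    using expected_loss_spiked[OF N len(1) that, of v] by (simp add: E_def B_def C_def)
  have pos: "(1 / ?K) ^ m > 0"
    using K by simp
  have tail: "drop (Suc m - N) (w @ [v]) = drop (Suc m - N) w @ [v]"
    using N len by simp
  have sumB: "(\<Sum>u\<in>UNIV. B y u) = ?K - 1"
    if "drop (Suc m - N) y = drop (Suc m - N) w @ [v]" for y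
  proof -
    have "(\<Sum>u\<in>UNIV. B y u) = (\<Sum>u\<in>UNIV. 1 - of_bool (u = v))"
      using that by (intro sum.cong) (auto simp: B_def)
    then show ?thesis
      by (simp add: sum_subtractf)
  qed
  have best: "B (w @ [v]) v - (\<Sum>u\<in>UNIV. B (w @ [v]) u) / ?K < 0"
    using K sumB[OF tail] tail by (simp add: B_def)
  have miss: "B y' v - (\<Sum>u\<in>UNIV. B y' u) / ?K \<ge> 0"
    if "drop (Suc m - N) y' \<noteq> drop (Suc m - N) w @ [v]"
  proof -
    have "(\<Sum>u\<in>UNIV. B y' u) \<le> (\<Sum>u\<in>(UNIV :: 'v set). 1)"
      by (intro sum_mono) (simp add: B_def)
    then show ?thesis
      using that K by (simp add: B_def field_simps)
  qed
  have strict: "E (w @ [v]) < E y'" if "drop (Suc m - N) y' \<noteq> drop (Suc m - N) w @ [v]"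
    using best miss[OF that] pos len by (simp add: E)
  \<comment> \<open>Equality occurs when \<open>y'\<close> differs from \<open>w @ [v]\<close> only
    before the last window; the minimiser need not be unique, but its last token is.\<close>
  show "E (w @ [v]) \<le> E y'"
  proof (cases "drop (Suc m - N) y' = drop (Suc m - N) w @ [v]")
    case True
    then have "B y' = B (w @ [v])"
      using tail by (simp add: B_def)
    then show ?thesis
      using len by (simp add: E)
  qed (use strict in simp)
  show "E (w @ [v]) < E y'" if "last y' \<noteq> v"
  proof (rule strict)
    \<comment> \<open>Since N \<ge> 1, the last window is nonempty and contains the final
      token.\<close>
    have "last (drop (Suc m - N) y') = last y'"
      using N len by (intro last_drop) simp
    then show "drop (Suc m - N) y' \<noteq> drop (Suc m - N) w @ [v]"
      using that by auto
  qed
qed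

section \<open>From optimality to a query count\<close>

lemma queries_lower_bound:
  fixes t :: "'v::finite query_tree"
  assumes K: "CARD('v) \<ge> 2"
    and last: "\<And>w v. length w = m \<Longrightarrow> last (tree_output t (spiked_predictor w v)) = v"
  shows "CARD('v) ^ m \<le> length (tree_queries t uniform_predictor)"
proof -
  let ?Q = "tree_queries t uniform_predictor"
  have "w \<in> set (map fst ?Q)" if "length w = m" for w
  proof (rule ccontr)
    assume "w \<notin> set (map fst ?Q)"
    then have "tree_output t (spiked_predictor w v) = tree_output t uniform_predictor" for v
      unfolding spiked_predictor_def by (intro tree_output_cong_unqueried) simp
    then have "v = last (tree_output t uniform_predictor)" for v
      using last[OF that, of v] by simp
    then have "(UNIV :: 'v set) \<subseteq> {last (tree_output t uniform_predictor)}"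
      by blast
    from card_mono[OF _ this] show False
      using K by simp
  qed
  \<comment> \<open>All these prefixes are queried in one and the same run, so they can be counted
    together.\<close>
  then have "card {w :: 'v list. length w = m} \<le> card (set (map fst ?Q))"
    by (intro card_mono) auto
  also have "\<dots> \<le> length ?Q"
    using card_length[of "map fst ?Q"] by simp
  finally show ?thesis
    by (simp add: card_lists_length_UNIV)
qed

text \<open>The nonnegative function \<open>f - c\<close> has integral 0. This turns a random output
  that is optimal on average into one that is optimal for almost every seed.\<close>

lemma (in prob_space) AE_eq_of_expectation_le:
  fixes f :: "'a \<Rightarrow> real"
  assumes "integrable M f" and "\<And>\<omega>. \<omega> \<in> space M \<Longrightarrow> c \<le> f \<omega>" and "expectation f \<le> c"
  shows "AE \<omega> in M. f \<omega> = c"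
proof -
  have int: "integrable M (\<lambda>\<omega>. f \<omega> - c)"
    using assms(1) by simp
  have nonneg: "AE \<omega> in M. 0 \<le> f \<omega> - c"
    using assms(2) by simp
  have "expectation (\<lambda>\<omega>. f \<omega> - c) = expectation f - c"
    using assms(1) by (simp add: prob_space)
  moreover have "0 \<le> expectation (\<lambda>\<omega>. f \<omega> - c)"
    using nonneg by (rule integral_nonneg_AE)
  ultimately have "expectation (\<lambda>\<omega>. f \<omega> - c) = 0"
    using assms(3) by linarith
  then show ?thesis
    using integral_nonneg_eq_0_iff_AE[OF int nonneg] by simp
qed

text \<open>Comparing the decoder with the constant output \<open>w @ [v]\<close> forces the final
  token \<open>v\<close> on every spiked predictor, surely or almost surely, and
  \<open>queries_lower_bound\<close> then applies seed by seed.\<close>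

lemma optimal_decoder_lower_bound:
  fixes A :: "('v::finite, 's) decoder"
  assumes K: "CARD('v) \<ge> 2" and "\<tau> > 0" and N: "1 \<le> N" "N \<le> Suc m"
    and A: "decoder_for_length (Suc m) A"
    and opt: "\<And>q. optimal_for N (Suc m) q A"
  shows "ennreal (\<tau> * real CARD('v) ^ m) \<le> running_time \<tau> uniform_predictor A"
proof -
  define E where "E w v = expected_loss N (Suc m) (spiked_predictor w v)" for w :: "'v list" and v
  note E_min = expected_loss_spiked_minimum[OF K N, folded E_def]
  have loss: "decoder_loss N (Suc m) (spiked_predictor w v) A \<le> E w v (w @ [v])"
    if "length w = m" for w v
    using opt[unfolded optimal_for_def, rule_format, of "return_pmf (w @ [v])"] that
    by (simp add: E_def)
  have cost: "\<tau> * real CARD('v) ^ m \<le> \<tau> * real (length (tree_queries t uniform_predictor))"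
    if "\<And>w v. length w = m \<Longrightarrow> last (tree_output t (spiked_predictor w v)) = v"
    for t :: "'v query_tree"
    using queries_lower_bound[OF K, of m t] that \<open>\<tau> > 0\<close>
    by (intro mult_left_mono) (simp_all flip: of_nat_power)
  show ?thesis
  proof (cases A)
    case (Deterministic t)
    have "last (tree_output t (spiked_predictor w v)) = v" if "length w = m" for w v
    proof (rule ccontr)
      assume "last (tree_output t (spiked_predictor w v)) \<noteq> v"
      moreover have "length (tree_output t (spiked_predictor w v)) = Suc m"
        using A Deterministic by (simp add: tree_for_length_def)
      ultimately have "E w v (w @ [v]) < E w v (tree_output t (spiked_predictor w v))"
        using E_min(2) that by blast
      then show False
        using loss[OF that, of v] Deterministic by (simp add: E_def)
    qed
    from cost[OF this] show ?thesis
      using Deterministic by (simp add: ennreal_leI)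
  next
    case (Stochastic M T)
    then interpret prob_space M
      using A by simp
    have len: "length (tree_output (T \<omega>) q) = Suc m" if "\<omega> \<in> space M" for \<omega> q
      using A Stochastic that by (simp add: tree_for_length_def)
    have "AE \<omega> in M. last (tree_output (T \<omega>) (spiked_predictor w v)) = v"
      if w: "length w = m" for w v
    proof -
      define f where "f \<omega> = E w v (tree_output (T \<omega>) (spiked_predictor w v))" for \<omega>
      have "(\<lambda>\<omega>. tree_output (T \<omega>) (spiked_predictor w v)) \<in> M \<rightarrow>\<^sub>M count_space UNIV"
        using A Stochastic by simp
      then have meas: "f \<in> borel_measurable M"
        unfolding f_def by (rule measurable_compose) simp
      \<comment> \<open>Outputs have length \<open>Suc m\<close>, so \<open>f\<close> takes finitely
        many values; the sum of their absolute values is a crude bound that gives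
        integrability.\<close>
      have "AE \<omega> in M. norm (f \<omega>) \<le> (\<Sum>y | length y = Suc m. \<bar>E w v y\<bar>)"
        using len
        by (intro AE_I2) (auto simp: f_def finite_lists_length_eq_UNIV
            intro!: member_le_sum[where f = "\<lambda>y. \<bar>E w v y\<bar>"])
      then have "integrable M f"
        using meas by (rule integrable_const_bound)
      moreover have "E w v (w @ [v]) \<le> f \<omega>" if "\<omega> \<in> space M" for \<omega>
        unfolding f_def using E_min(1) w len[OF that] by blast
      moreover have "expectation f \<le> E w v (w @ [v])"
        using loss[OF w, of v] Stochastic unfolding f_def by (simp add: E_def)
      ultimately have "AE \<omega> in M. f \<omega> = E w v (w @ [v])"
        by (rule AE_eq_of_expectation_le)
      with AE_space show ?thesis
      proof eventually_elim
        case (elim \<omega>)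
        then show ?case
          using E_min(2)[OF w len[OF elim(1), of "spiked_predictor w v"], of v]
          unfolding f_def by fastforce
      qed
    qed
    \<comment> \<open>The exceptional null set depends on \<open>w\<close> and \<open>v\<close>;
      finitely many pairs leave a common one.\<close>
    then have "AE \<omega> in M. \<forall>w\<in>{w. length w = m}. \<forall>v\<in>UNIV.
        last (tree_output (T \<omega>) (spiked_predictor w v)) = v"
      by (intro AE_finite_allI finite_lists_length_eq_UNIV finite) simp
    then have "AE \<omega> in M. ennreal (\<tau> * real CARD('v) ^ m)
        \<le> ennreal (\<tau> * real (length (tree_queries (T \<omega>) uniform_predictor)))"
      by eventually_elim (intro ennreal_leI cost, simp)
    then have "(\<integral>\<^sup>+ \<omega>. ennreal (\<tau> * real CARD('v) ^ m) \<partial>M) \<le> running_time \<tau> uniform_predictor A"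
      unfolding Stochastic running_time.simps by (rule nn_integral_mono_AE)
    then show ?thesis
      by (simp add: emeasure_space_1)
  qed
qed

theorem corollary4p2p1:
  fixes N :: "nat \<Rightarrow> nat"
    and A :: "nat \<Rightarrow> ('v::finite, 's) decoder"
    and \<tau> :: real
  assumes "CARD('v) \<ge> 2"
    and "\<tau> > 0"
    and "\<And>L. L \<ge> 1 \<Longrightarrow> 1 \<le> N L \<and> N L \<le> L"
    and "\<And>L. L \<ge> 1 \<Longrightarrow> decoder_for_length L (A L)"
    and "\<And>L q. L \<ge> 1 \<Longrightarrow> optimal_for (N L) L q (A L)"
  shows "\<exists>c a :: real. c > 0 \<and> a > 1 \<and> (\<forall>L\<ge>1. ennreal (c * a ^ L) \<le> worst_case_time \<tau> (A L))"
proof (intro exI conjI allI impI)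
  \<comment> \<open>The base is the vocabulary size; the factor \<open>1 / CARD('v)\<close> in
    \<open>c\<close> turns the exponent \<open>L - 1\<close> into \<open>L\<close>.\<close>
  show "\<tau> / CARD('v) > 0" and "real CARD('v) > 1"
    using assms(1,2) by simp_all
  fix L :: nat
  assume "L \<ge> 1"
  then obtain m where L: "L = Suc m"
    by (cases L) auto
  have "ennreal (\<tau> / CARD('v) * real CARD('v) ^ L) = ennreal (\<tau> * real CARD('v) ^ m)"
    using assms(1) by (simp add: L)
  also have "\<dots> \<le> running_time \<tau> uniform_predictor (A L)"
    using assms(3)[OF \<open>L \<ge> 1\<close>] assms(4,5)[OF \<open>L \<ge> 1\<close>] unfolding L
    by (intro optimal_decoder_lower_bound[OF assms(1,2)]) auto
  also have "\<dots> \<le> worst_case_time \<tau> (A L)"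
    unfolding worst_case_time_def by (rule SUP_upper) simp
  finally show "ennreal (\<tau> / CARD('v) * real CARD('v) ^ L) \<le> worst_case_time \<tau> (A L)" .
qed

end
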